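(* a) $m_{\approx}(\emptyset)=\emptyset$ and $m_{\approx}(\widehat{\mathbb{R}})=m_{\approx}(\mathbb{R})=\widehat{\mathbb{R}}$. Let $\widehat A,\widehat B\subseteq\widehat{\mathbb{R}}$. Then: b) $m_{\approx}(m_{\approx}(\widehat A))=m_{\approx}(\widehat A)$. c) $m_{\approx}(\widehat A\cup\widehat B)=m_{\approx}(\widehat A)\cup m_{\approx}(\widehat B)$. d) $m_{\approx}(\widehat A\cap\widehat B)\subseteq m_{\approx}(\widehat A)\cap m_{\approx}(\widehat B)$ and $m_{\approx}(\widehat A)\setminus m_{\approx}(\widehat B)\subseteq m_{\approx}(\widehat A\setminus\widehat B)$. If $\widehat A,\widehat B\subseteq\mathbb{R}$, then $m_{\approx}(\widehat A\cap\widehat B)=m_{\approx}(\widehat A)\cap m_{\approx}(\widehat B)$ and $m_{\approx}(\widehat A\setminus\widehat B)=m_{\approx}(\widehat A)\setminus m_{\approx}(\widehat B)$. Let $\widehat{\mathbf A}$ be a collection of subsets of $\widehat{\mathbb{R}}$. Then: e) $m_{\approx}\left(\bigcup\{\widehat A\mid\widehat A\in\widehat{\mathbf A}\}\right)=\bigcup\{m_{\approx}(\widehat A)\mid\widehat A\in\widehat{\mathbf A}\}$. f) $m_{\approx}\left(\bigcap\{\widehat A\mid\widehat A\in\widehat{\mathbf A}\}\right)\subseteq\bigcap\{m_{\approx}(\widehat A)\mid\widehat A\in\widehat{\mathbf A}\}$. If $\widehat{\mathbf A}$ is a collection of subsets of $\mathbb{R}$, then $m_{\approx}\left(\bigcap\{\widehat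 A\mid\widehat A\in\widehat{\mathbf A}\}\right)=\bigcap\{m_{\approx}(\widehat A)\mid\widehat A\in\widehat{\mathbf A}\}$.
   Context: $\widehat{\mathbb{R}}$ is the set of all convergent sequences of real numbers; a real number is identified with the corresponding constant sequence, so $\mathbb{R}\subseteq\widehat{\mathbb{R}}$. $\sigma x\in\mathbb{R}$ is the limit of $x$, and $x\approx y$ means $\sigma x=\sigma y$. For $\widehat A\subseteq\widehat{\mathbb{R}}$, the monad of $\widehat A$ is $m_{\approx}(\widehat A):=\{x\in\widehat{\mathbb{R}}\mid(\exists y\in\widehat A)\,x\approx y\}$. The intersection of an empty collection of subsets of $\widehat{\mathbb{R}}$ is understood to be $\widehat{\mathbb{R}}$. *)

theory Defs
  imports Complex_Main
begin

definition Rhat :: "(nat \<Rightarrow> real) set"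
  where "Rhat = {x. convergent x}"

text \<open>The copy of the real line inside \<^term>\<open>Rhat\<close>: a real number is identified with
  the corresponding constant sequence.\<close>

definition Rconst :: "(nat \<Rightarrow> real) set"
  where "Rconst = range (\<lambda>r n. r)"

text \<open>The limit of a sequence; only meaningful on \<^term>\<open>Rhat\<close>, to which all uses
  below are restricted.\<close>

definition shadow :: "(nat \<Rightarrow> real) \<Rightarrow> real"
  where "shadow x = lim x"

definition approx :: "(nat \<Rightarrow> real) \<Rightarrow> (nat \<Rightarrow> real) \<Rightarrow> bool"  (infix "\<approx>" 50)
  where "x \<approx> y \<longleftrightarrow> shadow x = shadow y"

definition monad :: "(nat \<Rightarrow> real) set \<Rightarrow> (nat \<Rightarrow> real) set"
  where "monad A = {x \<in> Rhat. \<exists>y\<in>A. x \<approx> y}"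

text \<open>Intersection of a collection of subsets of \<^term>\<open>Rhat\<close>. The library's
  intersection of the empty collection is \<^term>\<open>UNIV\<close>, whereas here it has to be
  \<^term>\<open>Rhat\<close>.\<close>

definition InterRhat :: "(nat \<Rightarrow> real) set set \<Rightarrow> (nat \<Rightarrow> real) set"
  where "InterRhat \<A> = {x \<in> Rhat. \<forall>A\<in>\<A>. x \<in> A}"

end

theory Submission
  imports Defs
begin

text \<open>A set of constant sequences contains at most one representative of each
  \<open>\<approx>\<close>-class, so membership of \<open>x\<close> in its monad is decided by the single
  sequence that is constantly \<open>shadow x\<close>. Hence on such sets the monad is a preimage
  and commutes with all Boolean operations.\<close>

lemma shadow_const [simp]: "shadow (\<lambda>n. r) = r"
  by (simp add: shadow_def)

lemma Rconst_subset_Rhat: "Rconst \<subseteq> Rhat"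
  by (auto simp: Rconst_def Rhat_def convergent_const)

lemma monad_subset_Rhat: "monad A \<subseteq> Rhat"
  by (auto simp: monad_def)

lemma subset_monad: "A \<subseteq> Rhat \<Longrightarrow> A \<subseteq> monad A"
  by (auto simp: monad_def approx_def)

lemma monad_Rhat: "monad Rhat = Rhat"
  by (intro equalityI monad_subset_Rhat subset_monad order_refl)

text \<open>A convergent \<open>x\<close> has the same limit as the constant sequence with value
  \<open>shadow x\<close>, which serves as the witness.\<close>

lemma monad_Rconst: "monad Rconst = Rhat"
  by (auto simp: monad_def approx_def Rconst_def)

lemma monad_idem: "monad (monad A) = monad A"
  by (auto simp: monad_def approx_def)

lemma monad_Un: "monad (A \<union> B) = monad A \<union> monad B"
  by (auto simp: monad_def)

lemma monad_Union: "monad (\<Union>\<A>) = \<Union> (monad ` \<A>)"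
  by (auto simp: monad_def)

lemma monad_Int_subset: "monad (A \<inter> B) \<subseteq> monad A \<inter> monad B"
  by (auto simp: monad_def)

text \<open>A witness in \<open>A\<close> for \<open>x\<close> cannot lie in \<open>B\<close>, since
  it would then put \<open>x\<close> into \<open>monad B\<close>.\<close>

lemma monad_Diff_subset: "monad A - monad B \<subseteq> monad (A - B)"
  by (auto simp: monad_def)

lemma monad_InterRhat_subset: "monad (InterRhat \<A>) \<subseteq> InterRhat (monad ` \<A>)"
  by (auto simp: monad_def InterRhat_def)

lemma monad_constants:
  assumes "A \<subseteq> Rconst"
  shows "monad A = {x \<in> Rhat. (\<lambda>n. shadow x) \<in> A}"
proof -
  \<comment> \<open>A constant sequence is recovered from its limit, so the only possible witness
    \<open>y\<close> for \<open>x\<close> is the constant sequence at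
    \<open>shadow x\<close>.\<close>
  have "(\<lambda>n. shadow y) = y" if "y \<in> A" for y
    using assms that by (auto simp: Rconst_def)
  then show ?thesis
    unfolding monad_def approx_def by (metis shadow_const)
qed

lemma monad_Int_constants:
  assumes "A \<subseteq> Rconst" "B \<subseteq> Rconst"
  shows "monad (A \<inter> B) = monad A \<inter> monad B"
  \<comment> \<open>\<open>le_infI1\<close> supplies \<open>A \<inter> B \<subseteq> Rconst\<close>,
    so that \<open>monad_constants\<close> rewrites all three monads.\<close>
  using assms by (auto simp: monad_constants le_infI1)

lemma monad_Diff_constants:
  assumes "A \<subseteq> Rconst" "B \<subseteq> Rconst"
  shows "monad (A - B) = monad A - monad B"
proof -
  have "A - B \<subseteq> Rconst"
    using assms by blast
  then show ?thesis
    using assms by (auto simp: monad_constants)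
qed

lemma monad_InterRhat_constants:
  assumes "\<And>A. A \<in> \<A> \<Longrightarrow> A \<subseteq> Rconst"
  shows "monad (InterRhat \<A>) = InterRhat (monad ` \<A>)"
proof (cases "\<A> = {}")
  case True
  \<comment> \<open>here \<^term>\<open>InterRhat \<A>\<close> is \<^term>\<open>Rhat\<close>, which does not consist of constants\<close>
  then show ?thesis
    by (simp add: InterRhat_def monad_Rhat)
next
  case False
  \<comment> \<open>Any single member of the nonempty collection bounds the intersection.\<close>
  then have sub: "InterRhat \<A> \<subseteq> Rconst"
    using assms by (fastforce simp: InterRhat_def)
  \<comment> \<open>The constant sequence at \<open>shadow x\<close> thus meets the
    \<open>Rhat\<close> condition in \<open>InterRhat\<close>, and only membership in each
    \<open>A\<close> remains.\<close>
  have "(\<lambda>n. r) \<in> Rhat" for r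
    using Rconst_subset_Rhat by (auto simp: Rconst_def)
  then have "monad (InterRhat \<A>) = {x \<in> Rhat. \<forall>A\<in>\<A>. (\<lambda>n. shadow x) \<in> A}"
    unfolding monad_constants[OF sub] by (simp add: InterRhat_def)
  also have "\<dots> = InterRhat (monad ` \<A>)"
    using assms by (auto simp: InterRhat_def monad_constants)
  finally show ?thesis .
qed

theorem proposition4p5:
  shows "(monad {} = {} \<and> monad Rhat = Rhat \<and> monad Rconst = Rhat)
    \<and> (\<forall>A B. A \<subseteq> Rhat \<longrightarrow> B \<subseteq> Rhat \<longrightarrow>
          monad (monad A) = monad A
        \<and> monad (A \<union> B) = monad A \<union> monad B
        \<and> monad (A \<inter> B) \<subseteq> monad A \<inter> monad B
        \<and> monad A - monad B \<subseteq> monad (A - B)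
        \<and> (A \<subseteq> Rconst \<longrightarrow> B \<subseteq> Rconst \<longrightarrow>
              monad (A \<inter> B) = monad A \<inter> monad B
            \<and> monad (A - B) = monad A - monad B))
    \<and> (\<forall>\<A>. (\<forall>A\<in>\<A>. A \<subseteq> Rhat) \<longrightarrow>
          monad (\<Union>\<A>) = \<Union> {monad A | A. A \<in> \<A>}
        \<and> monad (InterRhat \<A>) \<subseteq> InterRhat {monad A | A. A \<in> \<A>}
        \<and> ((\<forall>A\<in>\<A>. A \<subseteq> Rconst) \<longrightarrow>
              monad (InterRhat \<A>) = InterRhat {monad A | A. A \<in> \<A>}))"
proof -
  have empty: "monad {} = {}"
    by (simp add: monad_def)
  \<comment> \<open>This brings the families of monads into the form in which the lemmas on unions
    and intersections state them.\<close>
  have image: "{monad A | A. A \<in> \<A>} = monad ` \<A>" for \<A>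
    by blast
  show ?thesis
    unfolding image
    by (intro conjI allI impI empty monad_Rhat monad_Rconst monad_idem monad_Un
        monad_Int_subset monad_Diff_subset monad_Int_constants monad_Diff_constants
        monad_Union monad_InterRhat_subset monad_InterRhat_constants) auto
qed

end
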